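(* Let $\mathcal C$ be an essentially small category and $\mathcal J$ a stable notion of covering presieve of $\mathcal C$. Let $J$ be the associated notion of covering sieve: a sieve on an object $X$ is $J$-covering if it is the maximal sieve on $X$ or contains at least one presieve which is an element of $\mathcal J$. Let $\overline J$ be the topology of $\mathcal C$ generated by $J$. Then a sieve $C\hookrightarrow y(X)$ on an object $X$ of $\mathcal C$ is covering for $\overline J$ if and only if there exists a multi-covering of type $\mathcal J$ of $X$, consisting of a tree with finite branches $A_\bullet=(A_0\xleftarrow{f_1}A_1\leftarrow\cdots\leftarrow A_{n-1}\xleftarrow{f_n}A_n\leftarrow\cdots)$, objects $X_{n,a}$ ($n\in\mathbb N$, $a\in A_n$) with $X_{0,a_0}=X$, and morphisms $x_{n,a}:X_{n,a}\to X_{n-1,f_n(a)}$ ($n\ge1$, $a\in A_n$), such that for all $n\in\mathbb N$ and $a\in A_n$ at least one of the following holds: - $a$ is in the image of $f_{n+1}:A_{n+1}\to A_n$, i.e. the node $(n,a)$ is not maximal; - the empty family of morphisms with target $X_{n,a}$ is an element of $\mathcal J$; - writing $a=a_n$, $f_n(a_n)=a_{n-1},\dots,f_1(a_1)=a_0$, the composite $$X_{n,a_n}\xrightarrow{x_{n,a_n}}X_{n-1,a_{n-1}}\to\cdots\to X_{1,a_1}\xrightarrow{x_{1,a_1}}X_{0,a_0}=X$$ is an element of the sieve $C$.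
   Context: A presieve on $X$ is a family of morphisms with target $X$. A notion of covering presieve $\mathcal J$ is a collection of presieves (called $\mathcal J$-covering); it is stable if for every morphism $x:X'\to X$ and every $\mathcal J$-covering presieve $(X_i\xrightarrow{x_i}X)_{i\in I}$ there is a $\mathcal J$-covering presieve $(X'_j\xrightarrow{x'_j}X')_{j\in I'}$ such that for every $j\in I'$ there are $i\in I$ and a morphism $X'_j\to X_i$ making the square with $x'_j$, $x_i$ and $x$ commute. The topology generated by $J$ is the smallest Grothendieck topology containing the sieves in $J$. A tree $A_\bullet$ is a sequence of sets $A_n$, $n\in\mathbb N$, with $A_0=\{a_0\}$ a singleton, and maps $f_n:A_n\to A_{n-1}$, $n\ge1$. Its nodes are the pairs $(n,a)$ with $a\in A_n$, ordered by $(n,a)\ge(m,b)$ iff $n\ge m$ and $b=(f_{m+1}\circ\cdots\circ f_n)(a)$. It has finite branches if every non-empty subset of the ordered set of nodes has at least one maximal element. A multi-covering of type $\mathcal J$ of $X$ consists of a tree with finite branches $A_\bullet$, objects $X_{n,a}$ of $\mathcal C$ indexed by the nodes, with $X_{0,a_0}=X$, and morphisms $x_{n,a}:X_{n,a}\to X_{n-1,f_n(a)}$ ($n\ge1$, $a\in A_n$), such that for every non-maximal node $(n,a)$ (i.e. $f_{n+1}^{-1}(a)\neq\emptyset$) the family $(x_{n+1,a'}:X_{n+1,a'}\to X_{n,a})_{a'\in f_{n+1}^{-1}(a)}$ is a $\mathcal J$-covering presieve. *)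

theory Defs
  imports Main
begin

section \<open>Categories\<close>

record ('o, 'm) cat =
  Obj :: "'o set"
  Arr :: "'m set"
  Dom :: "'m \<Rightarrow> 'o"
  Cod :: "'m \<Rightarrow> 'o"
  Id :: "'o \<Rightarrow> 'm"
  Comp :: "'m \<Rightarrow> 'm \<Rightarrow> 'm"

text \<open>\<open>Comp C g f\<close> is the composite of \<open>f\<close> followed by \<open>g\<close>; it is only
  meaningful when \<open>Dom C g = Cod C f\<close>.\<close>

locale category =
  fixes C :: "('o, 'm) cat"
  assumes dom_obj: "f \<in> Arr C \<Longrightarrow> Dom C f \<in> Obj C"
    and cod_obj: "f \<in> Arr C \<Longrightarrow> Cod C f \<in> Obj C"
    and id_arr: "X \<in> Obj C \<Longrightarrow> Id C X \<in> Arr C"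
    and id_dom: "X \<in> Obj C \<Longrightarrow> Dom C (Id C X) = X"
    and id_cod: "X \<in> Obj C \<Longrightarrow> Cod C (Id C X) = X"
    and comp_arr: "\<lbrakk>g \<in> Arr C; f \<in> Arr C; Dom C g = Cod C f\<rbrakk> \<Longrightarrow> Comp C g f \<in> Arr C"
    and comp_dom: "\<lbrakk>g \<in> Arr C; f \<in> Arr C; Dom C g = Cod C f\<rbrakk> \<Longrightarrow> Dom C (Comp C g f) = Dom C f"
    and comp_cod: "\<lbrakk>g \<in> Arr C; f \<in> Arr C; Dom C g = Cod C f\<rbrakk> \<Longrightarrow> Cod C (Comp C g f) = Cod C g"
    and comp_id: "f \<in> Arr C \<Longrightarrow> Comp C f (Id C (Dom C f)) = f"
    and id_comp: "f \<in> Arr C \<Longrightarrow> Comp C (Id C (Cod C f)) f = f"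
    and comp_assoc: "\<lbrakk>h \<in> Arr C; g \<in> Arr C; f \<in> Arr C; Dom C h = Cod C g; Dom C g = Cod C f\<rbrakk>
      \<Longrightarrow> Comp C (Comp C h g) f = Comp C h (Comp C g f)"

definition is_functor ::
  "('o, 'm) cat \<Rightarrow> ('p, 'n) cat \<Rightarrow> ('o \<Rightarrow> 'p) \<Rightarrow> ('m \<Rightarrow> 'n) \<Rightarrow> bool" where
  "is_functor C D Fo Fm \<longleftrightarrow>
     (\<forall>X\<in>Obj C. Fo X \<in> Obj D \<and> Fm (Id C X) = Id D (Fo X)) \<and>
     (\<forall>f\<in>Arr C. Fm f \<in> Arr D \<and> Dom D (Fm f) = Fo (Dom C f) \<and> Cod D (Fm f) = Fo (Cod C f)) \<and>
     (\<forall>g\<in>Arr C. \<forall>f\<in>Arr C. Dom C g = Cod C f \<longrightarrow> Fm (Comp C g f) = Comp D (Fm g) (Fm f))"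

definition is_iso :: "('o, 'm) cat \<Rightarrow> 'm \<Rightarrow> bool" where
  "is_iso C f \<longleftrightarrow> f \<in> Arr C \<and>
     (\<exists>g\<in>Arr C. Dom C g = Cod C f \<and> Cod C g = Dom C f \<and>
        Comp C g f = Id C (Dom C f) \<and> Comp C f g = Id C (Cod C f))"

definition naturally_isomorphic ::
  "('o, 'm) cat \<Rightarrow> ('p, 'n) cat \<Rightarrow> ('o \<Rightarrow> 'p) \<Rightarrow> ('m \<Rightarrow> 'n) \<Rightarrow> ('o \<Rightarrow> 'p) \<Rightarrow> ('m \<Rightarrow> 'n) \<Rightarrow> bool" where
  "naturally_isomorphic C D Fo Fm Go Gm \<longleftrightarrow>
     (\<exists>\<eta>. (\<forall>X\<in>Obj C. is_iso D (\<eta> X) \<and> Dom D (\<eta> X) = Fo X \<and> Cod D (\<eta> X) = Go X) \<and>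
          (\<forall>f\<in>Arr C. Comp D (Gm f) (\<eta> (Dom C f)) = Comp D (\<eta> (Cod C f)) (Fm f)))"

definition equivalent_cat :: "('o, 'm) cat \<Rightarrow> ('p, 'n) cat \<Rightarrow> bool" where
  "equivalent_cat C D \<longleftrightarrow>
     (\<exists>Fo Fm Go Gm. is_functor C D Fo Fm \<and> is_functor D C Go Gm \<and>
        naturally_isomorphic C C (\<lambda>X. Go (Fo X)) (\<lambda>f. Gm (Fm f)) (\<lambda>X. X) (\<lambda>f. f) \<and>
        naturally_isomorphic D D (\<lambda>Y. Fo (Go Y)) (\<lambda>g. Fm (Gm g)) (\<lambda>Y. Y) (\<lambda>g. g))"

text \<open>Size is measured by a type \<open>'u\<close>: the small sets are the subsets of \<open>'u\<close>. The same
  type supplies the index sets of presieves and the levels of trees.\<close>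

definition essentially_small :: "'u itself \<Rightarrow> ('o, 'm) cat \<Rightarrow> bool" where
  "essentially_small _ C \<longleftrightarrow> (\<exists>D :: ('u, 'u) cat. category D \<and> equivalent_cat C D)"


section \<open>Sieves and Grothendieck topologies\<close>

text \<open>Subfunctors of the representable presheaf on \<open>X\<close> are identified, as usual, with sets of
  arrows with codomain \<open>X\<close> stable under precomposition.\<close>

definition maximal_sieve :: "('o, 'm) cat \<Rightarrow> 'o \<Rightarrow> 'm set" where
  "maximal_sieve C X = {f \<in> Arr C. Cod C f = X}"

definition sieve_on :: "('o, 'm) cat \<Rightarrow> 'o \<Rightarrow> 'm set \<Rightarrow> bool" where
  "sieve_on C X S \<longleftrightarrow> S \<subseteq> maximal_sieve C X \<and>
     (\<forall>f\<in>S. \<forall>g\<in>Arr C. Cod C g = Dom C f \<longrightarrow> Comp C f g \<in> S)"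

definition pullback_sieve :: "('o, 'm) cat \<Rightarrow> 'm \<Rightarrow> 'm set \<Rightarrow> 'm set" where
  "pullback_sieve C f S = {g \<in> Arr C. Cod C g = Dom C f \<and> Comp C f g \<in> S}"

definition grothendieck_topology :: "('o, 'm) cat \<Rightarrow> ('o \<Rightarrow> 'm set set) \<Rightarrow> bool" where
  "grothendieck_topology C K \<longleftrightarrow>
     (\<forall>X\<in>Obj C. \<forall>S\<in>K X. sieve_on C X S) \<and>
     (\<forall>X\<in>Obj C. maximal_sieve C X \<in> K X) \<and>
     (\<forall>f\<in>Arr C. \<forall>S\<in>K (Cod C f). pullback_sieve C f S \<in> K (Dom C f)) \<and>
     (\<forall>X\<in>Obj C. \<forall>S\<in>K X. \<forall>R. sieve_on C X R \<and>
        (\<forall>f\<in>S. pullback_sieve C f R \<in> K (Dom C f)) \<longrightarrow> R \<in> K X)"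

definition generated_topology :: "('o, 'm) cat \<Rightarrow> ('o \<Rightarrow> 'm set set) \<Rightarrow> 'o \<Rightarrow> 'm set set" where
  "generated_topology C J X =
     \<Inter> {K X | K. grothendieck_topology C K \<and> (\<forall>Y\<in>Obj C. J Y \<subseteq> K Y)}"


section \<open>Notions of covering presieve\<close>

text \<open>\<open>(X, I, x)\<close> is the family of the \<open>x i\<close>, \<open>i \<in> I\<close>, with target \<open>X\<close>.
  Repetitions are allowed; the target is recorded because \<open>I\<close> may be empty.\<close>

type_synonym ('o, 'm, 'u) presieve = "'o \<times> 'u set \<times> ('u \<Rightarrow> 'm)"

definition is_presieve :: "('o, 'm) cat \<Rightarrow> ('o, 'm, 'u) presieve \<Rightarrow> bool" where
  "is_presieve C = (\<lambda>(X, I, x). X \<in> Obj C \<and> (\<forall>i\<in>I. x i \<in> Arr C \<and> Cod C (x i) = X))"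

definition covering_notion :: "('o, 'm) cat \<Rightarrow> ('o, 'm, 'u) presieve set \<Rightarrow> bool" where
  "covering_notion C J \<longleftrightarrow> (\<forall>P\<in>J. is_presieve C P)"

text \<open>Families are considered up to renaming of their indices. Without this the fibres of a
  tree could not serve as index sets: distinct fibres at the same level are disjoint, whereas
  \<open>J\<close> may only contain families indexed by one particular set. This also makes the values of
  \<open>x\<close> outside \<open>I\<close> irrelevant.\<close>

definition covering_presieve :: "('o, 'm, 'u) presieve set \<Rightarrow> ('o, 'm, 'u) presieve \<Rightarrow> bool" where
  "covering_presieve J = (\<lambda>(X, I, x).
     \<exists>I' x' h. (X, I', x') \<in> J \<and> bij_betw h I I' \<and> (\<forall>i\<in>I. x i = x' (h i)))"

definition stable_notion :: "('o, 'm) cat \<Rightarrow> ('o, 'm, 'u) presieve set \<Rightarrow> bool" where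
  "stable_notion C J \<longleftrightarrow>
     (\<forall>t\<in>Arr C. \<forall>I x. covering_presieve J (Cod C t, I, x) \<longrightarrow>
        (\<exists>I' x'. covering_presieve J (Dom C t, I', x') \<and>
           (\<forall>j\<in>I'. \<exists>i\<in>I. \<exists>h\<in>Arr C. Dom C h = Dom C (x' j) \<and> Cod C h = Dom C (x i) \<and>
              Comp C t (x' j) = Comp C (x i) h)))"

definition associated_sieves ::
  "('o, 'm) cat \<Rightarrow> ('o, 'm, 'u) presieve set \<Rightarrow> 'o \<Rightarrow> 'm set set" where
  "associated_sieves C J X =
     {S. sieve_on C X S \<and>
         (S = maximal_sieve C X \<or> (\<exists>I x. covering_presieve J (X, I, x) \<and> x ` I \<subseteq> S))}"


section \<open>Trees and multi-coverings\<close>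

text \<open>The levels are \<open>A n\<close>; the transition map from \<open>A n\<close> to \<open>A (n - 1)\<close> is \<open>f n\<close>, and
  \<open>f 0\<close> is never used.\<close>

definition is_tree :: "(nat \<Rightarrow> 'u set) \<Rightarrow> (nat \<Rightarrow> 'u \<Rightarrow> 'u) \<Rightarrow> 'u \<Rightarrow> bool" where
  "is_tree A f a0 \<longleftrightarrow> A 0 = {a0} \<and> (\<forall>n. \<forall>a\<in>A (Suc n). f (Suc n) a \<in> A n)"

definition nodes :: "(nat \<Rightarrow> 'u set) \<Rightarrow> (nat \<times> 'u) set" where
  "nodes A = {(n, a). a \<in> A n}"

text \<open>\<open>iter_steps f m k\<close> is the composite of \<open>f (m + k)\<close>, ..., \<open>f (m + 1)\<close>, from level
  \<open>m + k\<close> to level \<open>m\<close>.\<close>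

primrec iter_steps :: "(nat \<Rightarrow> 'u \<Rightarrow> 'u) \<Rightarrow> nat \<Rightarrow> nat \<Rightarrow> 'u \<Rightarrow> 'u" where
  "iter_steps f m 0 = id"
| "iter_steps f m (Suc k) = iter_steps f m k \<circ> f (m + Suc k)"

definition node_ge :: "(nat \<Rightarrow> 'u \<Rightarrow> 'u) \<Rightarrow> nat \<times> 'u \<Rightarrow> nat \<times> 'u \<Rightarrow> bool" where
  "node_ge f = (\<lambda>(n, a) (m, b). n \<ge> m \<and> b = iter_steps f m (n - m) a)"

definition finite_branches :: "(nat \<Rightarrow> 'u set) \<Rightarrow> (nat \<Rightarrow> 'u \<Rightarrow> 'u) \<Rightarrow> bool" where
  "finite_branches A f \<longleftrightarrow>
     (\<forall>N. N \<subseteq> nodes A \<and> N \<noteq> {} \<longrightarrow> (\<exists>p\<in>N. \<forall>q\<in>N. node_ge f q p \<longrightarrow> q = p))"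

definition fibre :: "(nat \<Rightarrow> 'u set) \<Rightarrow> (nat \<Rightarrow> 'u \<Rightarrow> 'u) \<Rightarrow> nat \<Rightarrow> 'u \<Rightarrow> 'u set" where
  "fibre A f n a = {a' \<in> A (Suc n). f (Suc n) a' = a}"

definition multi_covering ::
  "('o, 'm) cat \<Rightarrow> ('o, 'm, 'u) presieve set \<Rightarrow> 'o \<Rightarrow> (nat \<Rightarrow> 'u set) \<Rightarrow> (nat \<Rightarrow> 'u \<Rightarrow> 'u) \<Rightarrow> 'u
    \<Rightarrow> (nat \<Rightarrow> 'u \<Rightarrow> 'o) \<Rightarrow> (nat \<Rightarrow> 'u \<Rightarrow> 'm) \<Rightarrow> bool" where
  "multi_covering C J X A f a0 Xs xs \<longleftrightarrow>
     is_tree A f a0 \<and> finite_branches A f \<and>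
     (\<forall>n. \<forall>a\<in>A n. Xs n a \<in> Obj C) \<and> Xs 0 a0 = X \<and>
     (\<forall>n. \<forall>a\<in>A (Suc n). xs (Suc n) a \<in> Arr C \<and> Dom C (xs (Suc n) a) = Xs (Suc n) a \<and>
        Cod C (xs (Suc n) a) = Xs n (f (Suc n) a)) \<and>
     (\<forall>n. \<forall>a\<in>A n. fibre A f n a \<noteq> {} \<longrightarrow>
        covering_presieve J (Xs n a, fibre A f n a, xs (Suc n)))"

text \<open>The composite along the branch from a node down to the root; for the root itself it is
  the identity.\<close>

primrec branch_comp ::
  "('o, 'm) cat \<Rightarrow> (nat \<Rightarrow> 'u \<Rightarrow> 'u) \<Rightarrow> (nat \<Rightarrow> 'u \<Rightarrow> 'o) \<Rightarrow> (nat \<Rightarrow> 'u \<Rightarrow> 'm) \<Rightarrow> nat \<Rightarrow> 'u \<Rightarrow> 'm" where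
  "branch_comp C f Xs xs 0 a = Id C (Xs 0 a)"
| "branch_comp C f Xs xs (Suc n) a =
     Comp C (branch_comp C f Xs xs n (f (Suc n) a)) (xs (Suc n) a)"

end

theory Submission
  imports Defs
begin

text \<open>
  Fix a sieve \<open>S\<close> on \<open>X\<close>. An arrow \<open>g\<close> into \<open>X\<close> is called locally in \<open>S\<close> if it lies in the
  smallest class of arrows containing \<open>S\<close> and closed under the rule: if \<open>J\<close> has a covering family
  \<open>x\<^sub>i\<close> of the source of \<open>g\<close> such that all \<open>g \<circ> x\<^sub>i\<close> are in the class, then so is \<open>g\<close>. Both sides
  of the equivalence say that the identity of \<open>X\<close> is locally in \<open>S\<close>.

  On the side of the topology, the sieves \<open>S\<close> for which the identity is locally in \<open>S\<close> form a
  Grothendieck topology (lemma \<open>grothendieck_topology_local\<close>). Stability of \<open>J\<close> is used once,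
  to see that being locally in \<open>S\<close> is inherited by composites \<open>g \<circ> t\<close>; the transitivity axiom
  is the minimality of the class. That this topology is the smallest one (lemma
  \<open>pullback_mem_topology\<close>) is an induction along the rule, each step of which is an instance of
  the transitivity axiom of an arbitrary topology containing the given sieves.

  On the side of multi-coverings, a multi-covering whose leaves are as required is exactly a
  derivation that the identity is locally in \<open>S\<close>, and finiteness of branches is well-foundedness
  of the derivation. From a multi-covering one obtains the derivation by looking at a
  maximal node whose branch composite is not locally in \<open>S\<close> (lemma \<open>multi_covering_imp_local\<close>).
  Conversely, a derivation is recorded as an element of an infinitely branching datatype, and its
  positions are spread out in levels, using an injection \<open>'u \<times> 'u \<Rightarrow> 'u\<close> to keep the nodes of a
  level distinct (locale \<open>unfolding_tree\<close>).
\<close>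

section \<open>Arrows that are locally in a sieve\<close>

inductive locally_in :: "('o, 'm) cat \<Rightarrow> ('o, 'm, 'u) presieve set \<Rightarrow> 'm set \<Rightarrow> 'm \<Rightarrow> bool"
  for C J S where
  base: "g \<in> S \<Longrightarrow> locally_in C J S g"
| step: "\<lbrakk>g \<in> Arr C; covering_presieve J (Dom C g, I, x);
    \<And>i. i \<in> I \<Longrightarrow> locally_in C J S (Comp C g (x i))\<rbrakk> \<Longrightarrow> locally_in C J S g"

lemma covering_presieve_is_presieve:
  assumes "covering_notion C J" and "covering_presieve J (X, I, x)"
  shows "X \<in> Obj C" and "\<And>i. i \<in> I \<Longrightarrow> x i \<in> Arr C \<and> Cod C (x i) = X"
proof -
  obtain I' x' h where *: "(X, I', x') \<in> J" "bij_betw h I I'" "\<forall>i\<in>I. x i = x' (h i)"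
    using assms(2) by (auto simp: covering_presieve_def)
  have "is_presieve C (X, I', x')"
    using assms(1) *(1) by (auto simp: covering_notion_def)
  then show "X \<in> Obj C" and "\<And>i. i \<in> I \<Longrightarrow> x i \<in> Arr C \<and> Cod C (x i) = X"
    using *(2,3) by (auto simp: is_presieve_def bij_betw_def)
qed

lemma covering_presieve_reindex:
  assumes "covering_presieve J (X, I, x)" and "bij_betw k I' I" and "\<And>i. i \<in> I' \<Longrightarrow> x' i = x (k i)"
  shows "covering_presieve J (X, I', x')"
proof -
  obtain L y h where *: "(X, L, y) \<in> J" "bij_betw h I L" "\<forall>i\<in>I. x i = y (h i)"
    using assms(1) by (auto simp: covering_presieve_def)
  have "bij_betw (h \<circ> k) I' L"
    using assms(2) *(2) by (rule bij_betw_trans)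
  moreover have "\<forall>i\<in>I'. x' i = y ((h \<circ> k) i)"
    using assms(2,3) *(3) by (auto simp: bij_betw_def)
  ultimately show ?thesis
    using *(1) unfolding covering_presieve_def by blast
qed

context category
begin

lemma sieve_on_arr: "sieve_on C X S \<Longrightarrow> g \<in> S \<Longrightarrow> g \<in> Arr C \<and> Cod C g = X"
  by (auto simp: sieve_on_def maximal_sieve_def)

lemma sieve_on_comp:
  "\<lbrakk>sieve_on C X S; g \<in> S; t \<in> Arr C; Cod C t = Dom C g\<rbrakk> \<Longrightarrow> Comp C g t \<in> S"
  by (auto simp: sieve_on_def)

lemma sieve_on_pullback:
  assumes "sieve_on C (Cod C f) S" and "f \<in> Arr C"
  shows "sieve_on C (Dom C f) (pullback_sieve C f S)"
proof -
  have "Comp C g t \<in> pullback_sieve C f S"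
    if g: "g \<in> pullback_sieve C f S" and t: "t \<in> Arr C" "Cod C t = Dom C g" for g t
  proof -
    have g': "g \<in> Arr C" "Cod C g = Dom C f" "Comp C f g \<in> S"
      using g by (auto simp: pullback_sieve_def)
    have "Comp C (Comp C f g) t \<in> S"
      using g' t assms(2) by (intro sieve_on_comp[OF assms(1) g'(3)]) (simp_all add: comp_dom)
    then show ?thesis
      using g' t assms(2) by (simp add: pullback_sieve_def comp_assoc comp_arr comp_cod)
  qed
  moreover have "pullback_sieve C f S \<subseteq> maximal_sieve C (Dom C f)"
    by (auto simp: pullback_sieve_def maximal_sieve_def)
  ultimately show ?thesis
    unfolding sieve_on_def by blast
qed

lemma pullback_sieve_comp:
  assumes "f \<in> Arr C" "g \<in> Arr C" "Dom C f = Cod C g"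
  shows "pullback_sieve C (Comp C f g) S = pullback_sieve C g (pullback_sieve C f S)"
  using assms by (auto simp: pullback_sieve_def comp_arr comp_dom comp_cod comp_assoc)

lemma pullback_sieve_id:
  assumes "sieve_on C X S" "X \<in> Obj C"
  shows "pullback_sieve C (Id C X) S = S"
proof (rule set_eqI)
  fix g
  show "g \<in> pullback_sieve C (Id C X) S \<longleftrightarrow> g \<in> S"
  proof (cases "g \<in> Arr C \<and> Cod C g = X")
    case True
    then have "Comp C (Id C X) g = g"
      using id_comp[of g] by simp
    then show ?thesis
      using True assms(2) by (simp add: pullback_sieve_def id_dom)
  next
    case False
    then show ?thesis
      using sieve_on_arr[OF assms(1), of g] assms(2) by (auto simp: pullback_sieve_def id_dom)
  qed
qed

lemma pullback_sieve_mem: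
  assumes "sieve_on C X S" "g \<in> S"
  shows "pullback_sieve C g S = maximal_sieve C (Dom C g)"
  using assms by (auto simp: pullback_sieve_def maximal_sieve_def intro: sieve_on_comp)

text \<open>Stability turns a covering family of the source of \<open>g\<close> into one of the source of \<open>t\<close> whose
  members, followed by \<open>t\<close>, factor through the given ones; the induction hypothesis then has to
  allow an arbitrary \<open>t\<close> to absorb these factors.\<close>

lemma locally_in_comp:
  assumes J: "covering_notion C J" "stable_notion C J"
    and S: "sieve_on C X S"
    and "locally_in C J S g" "t \<in> Arr C" "Cod C t = Dom C g"
  shows "locally_in C J S (Comp C g t)"
  using assms(4-)
proof (induction arbitrary: t rule: locally_in.induct)
  case (base g)
  then show ?case
    using S by (auto intro: locally_in.base sieve_on_comp)
next
  case (step g I x)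
  note x = covering_presieve_is_presieve(2)[OF J(1) step.hyps(2)]
  have "covering_presieve J (Cod C t, I, x)"
    using step.hyps(2) step.prems(2) by simp
  then obtain I' x' where x'_cov: "covering_presieve J (Dom C t, I', x')"
    and factor: "\<forall>j\<in>I'. \<exists>i\<in>I. \<exists>h\<in>Arr C. Dom C h = Dom C (x' j) \<and> Cod C h = Dom C (x i) \<and>
              Comp C t (x' j) = Comp C (x i) h"
    using J(2) step.prems(1) unfolding stable_notion_def by blast
  note x' = covering_presieve_is_presieve(2)[OF J(1) x'_cov]
  show ?case
  proof (rule locally_in.step)
    show "Comp C g t \<in> Arr C"
      using step by (auto intro: comp_arr)
    show "covering_presieve J (Dom C (Comp C g t), I', x')"
      using step x'_cov by (simp add: comp_dom)
  next
    fix j assume j: "j \<in> I'"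
    obtain i h where i: "i \<in> I" and h: "h \<in> Arr C" "Cod C h = Dom C (x i)"
      and eq: "Comp C t (x' j) = Comp C (x i) h"
      using factor j by blast
    have "Comp C (Comp C g t) (x' j) = Comp C g (Comp C t (x' j))"
      using step.hyps step.prems x'[OF j] by (intro comp_assoc) auto
    also have "\<dots> = Comp C (Comp C g (x i)) h"
      unfolding eq using step.hyps x[OF i] h by (intro comp_assoc[symmetric]) auto
    finally have "Comp C (Comp C g t) (x' j) = Comp C (Comp C g (x i)) h" .
    moreover have "locally_in C J S (Comp C (Comp C g (x i)) h)"
      using step.hyps(1) x[OF i] h by (intro step.IH[OF i]) (simp_all add: comp_dom)
    ultimately show "locally_in C J S (Comp C (Comp C g t) (x' j))"
      by simp
  qed
qed

lemma locally_in_pullbackI: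
  assumes J: "covering_notion C J" and f: "f \<in> Arr C"
    and "locally_in C J S k" "k = Comp C f g" "g \<in> Arr C" "Cod C g = Dom C f"
  shows "locally_in C J (pullback_sieve C f S) g"
  using assms(3-)
proof (induction arbitrary: g rule: locally_in.induct)
  case (base k)
  then show ?case
    by (auto intro: locally_in.base simp: pullback_sieve_def)
next
  case (step k I x)
  have cov: "covering_presieve J (Dom C g, I, x)"
    using step.hyps(2) step.prems f by (simp add: comp_dom)
  note x = covering_presieve_is_presieve(2)[OF J cov]
  show ?case
    using step.prems(2) cov
  proof (rule locally_in.step)
    fix i assume i: "i \<in> I"
    show "locally_in C J (pullback_sieve C f S) (Comp C g (x i))"
      using step.prems f x[OF i] by (intro step.IH[OF i]) (simp_all add: comp_arr comp_cod comp_assoc)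
  qed
qed

lemma locally_in_pullbackD:
  assumes J: "covering_notion C J" and f: "f \<in> Arr C"
    and "locally_in C J (pullback_sieve C f S) g" "g \<in> Arr C" "Cod C g = Dom C f"
  shows "locally_in C J S (Comp C f g)"
  using assms(3-)
proof (induction rule: locally_in.induct)
  case (base g)
  then show ?case
    by (auto intro: locally_in.base simp: pullback_sieve_def)
next
  case (step g I x)
  note x = covering_presieve_is_presieve(2)[OF J step.hyps(2)]
  show ?case
  proof (rule locally_in.step)
    show "Comp C f g \<in> Arr C"
      using step f by (simp add: comp_arr)
    show "covering_presieve J (Dom C (Comp C f g), I, x)"
      using step f by (simp add: comp_dom)
  next
    fix i assume i: "i \<in> I"
    have "locally_in C J S (Comp C f (Comp C g (x i)))"
      using step.prems x[OF i] by (intro step.IH[OF i]) (simp_all add: comp_arr comp_cod)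
    then show "locally_in C J S (Comp C (Comp C f g) (x i))"
      using step.prems x[OF i] f by (simp add: comp_assoc)
  qed
qed

lemma locally_in_trans:
  assumes "locally_in C J S g" and "\<And>f. f \<in> S \<Longrightarrow> locally_in C J R f"
  shows "locally_in C J R g"
  using assms(1) by induction (auto intro: assms(2) locally_in.step)

section \<open>The generated topology\<close>

lemma grothendieck_topology_local:
  assumes J: "covering_notion C J" "stable_notion C J"
  shows "grothendieck_topology C (\<lambda>X. {S. sieve_on C X S \<and> locally_in C J S (Id C X)})"
  unfolding grothendieck_topology_def mem_Collect_eq
proof (intro conjI ballI allI impI)
  fix X assume X: "X \<in> Obj C"
  show "sieve_on C X (maximal_sieve C X)"
    by (auto simp: sieve_on_def maximal_sieve_def comp_arr comp_cod)
  show "locally_in C J (maximal_sieve C X) (Id C X)"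
    using X by (auto intro: locally_in.base simp: maximal_sieve_def id_arr id_cod)
next
  fix f S assume f: "f \<in> Arr C" and "S \<in> {S. sieve_on C (Cod C f) S \<and> locally_in C J S (Id C (Cod C f))}"
  then have S: "sieve_on C (Cod C f) S" and loc: "locally_in C J S (Id C (Cod C f))"
    by auto
  show "sieve_on C (Dom C f) (pullback_sieve C f S)"
    using S f by (rule sieve_on_pullback)
  have "locally_in C J S (Comp C (Id C (Cod C f)) f)"
    using f by (intro locally_in_comp[OF J S loc]) (simp_all add: id_dom cod_obj)
  then have "locally_in C J S f"
    using f by (simp add: id_comp)
  then show "locally_in C J (pullback_sieve C f S) (Id C (Dom C f))"
    using f by (intro locally_in_pullbackI[OF J(1) f, of S f])
      (simp_all add: comp_id id_arr id_cod dom_obj)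
next
  fix X S R
  assume X: "X \<in> Obj C" and "S \<in> {S. sieve_on C X S \<and> locally_in C J S (Id C X)}"
    and R: "sieve_on C X R \<and> (\<forall>f\<in>S. sieve_on C (Dom C f) (pullback_sieve C f R) \<and>
      locally_in C J (pullback_sieve C f R) (Id C (Dom C f)))"
  then have S: "sieve_on C X S" and loc: "locally_in C J S (Id C X)"
    by auto
  show "sieve_on C X R"
    using R by simp
  have "locally_in C J R f" if f: "f \<in> S" for f
  proof -
    have arr: "f \<in> Arr C"
      using sieve_on_arr[OF S f] by simp
    have "locally_in C J R (Comp C f (Id C (Dom C f)))"
      using R f arr by (intro locally_in_pullbackD[OF J(1) arr]) (simp_all add: id_arr id_cod dom_obj)
    then show ?thesis
      using arr by (simp add: comp_id)
  qed
  then show "locally_in C J R (Id C X)"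
    by (rule locally_in_trans[OF loc])
qed auto

text \<open>One application of the rule defining \<^const>\<open>locally_in\<close> corresponds to one application of the
  transitivity axiom, to the sieve generated by the covering family.\<close>

lemma pullback_mem_topology:
  assumes J: "covering_notion C J"
    and K: "grothendieck_topology C K" "\<And>Y. Y \<in> Obj C \<Longrightarrow> associated_sieves C J Y \<subseteq> K Y"
    and S: "sieve_on C X S"
    and "locally_in C J S g" "g \<in> Arr C" "Cod C g = X"
  shows "pullback_sieve C g S \<in> K (Dom C g)"
  using assms(5-)
proof (induction rule: locally_in.induct)
  case (base g)
  then show ?case
    using K(1) pullback_sieve_mem[OF S] dom_obj by (simp add: grothendieck_topology_def)
next
  case (step g I x)
  note x = covering_presieve_is_presieve(2)[OF J step.hyps(2)]
  define T where "T = {Comp C (x i) h | i h. i \<in> I \<and> h \<in> Arr C \<and> Cod C h = Dom C (x i)}"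
  have "Comp C f k \<in> T" if f: "f \<in> T" and k: "k \<in> Arr C" "Cod C k = Dom C f" for f k
  proof -
    obtain i h where i: "i \<in> I" and h: "h \<in> Arr C" "Cod C h = Dom C (x i)" and f_eq: "f = Comp C (x i) h"
      using f by (auto simp: T_def)
    have "Dom C f = Dom C h"
      using x[OF i] h f_eq by (simp add: comp_dom)
    then have "Comp C f k = Comp C (x i) (Comp C h k)"
      and "Comp C h k \<in> Arr C" "Cod C (Comp C h k) = Dom C (x i)"
      using x[OF i] h k f_eq by (simp_all add: comp_assoc comp_arr comp_cod)
    then show ?thesis
      using i unfolding T_def by blast
  qed
  moreover have "T \<subseteq> maximal_sieve C (Dom C g)"
    using x by (auto simp: maximal_sieve_def T_def comp_arr comp_cod)
  ultimately have "sieve_on C (Dom C g) T"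
    unfolding sieve_on_def by blast
  moreover have "x i \<in> T" if i: "i \<in> I" for i
    unfolding T_def using i x[OF i] comp_id[of "x i"]
    by (auto intro!: exI[of _ i] exI[of _ "Id C (Dom C (x i))"] simp: id_arr id_cod dom_obj)
  ultimately have "T \<in> associated_sieves C J (Dom C g)"
    using step.hyps(2) by (auto simp: associated_sieves_def)
  then have T: "T \<in> K (Dom C g)"
    using K(2) step.hyps(1) dom_obj by blast
  have g_pb: "sieve_on C (Dom C g) (pullback_sieve C g S)"
    using S step.prems by (intro sieve_on_pullback) auto
  have "pullback_sieve C f (pullback_sieve C g S) \<in> K (Dom C f)" if f: "f \<in> T" for f
  proof -
    obtain i h where i: "i \<in> I" and h: "h \<in> Arr C" "Cod C h = Dom C (x i)" and f_eq: "f = Comp C (x i) h"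
      using f by (auto simp: T_def)
    have "pullback_sieve C (Comp C g (x i)) S \<in> K (Dom C (Comp C g (x i)))"
      using step.prems x[OF i] by (intro step.IH[OF i]) (simp_all add: comp_arr comp_cod)
    then have "pullback_sieve C (x i) (pullback_sieve C g S) \<in> K (Cod C h)"
      using step.prems x[OF i] h by (simp add: pullback_sieve_comp comp_dom)
    then have "pullback_sieve C h (pullback_sieve C (x i) (pullback_sieve C g S)) \<in> K (Dom C h)"
      using K(1) h(1) by (auto simp: grothendieck_topology_def)
    then show ?thesis
      using x[OF i] h f_eq by (simp add: pullback_sieve_comp comp_dom)
  qed
  with K(1) T g_pb show ?case
    using step.prems dom_obj unfolding grothendieck_topology_def by blast
qed

lemma mem_generated_topology_iff:
  assumes J: "covering_notion C J" "stable_notion C J"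
    and X: "X \<in> Obj C" and S: "sieve_on C X S"
  shows "S \<in> generated_topology C (associated_sieves C J) X \<longleftrightarrow> locally_in C J S (Id C X)"
proof
  define K where "K = (\<lambda>X. {S. sieve_on C X S \<and> locally_in C J S (Id C X)})"
  assume "S \<in> generated_topology C (associated_sieves C J) X"
  moreover have "associated_sieves C J Y \<subseteq> K Y" if Y: "Y \<in> Obj C" for Y
  proof
    fix T assume "T \<in> associated_sieves C J Y"
    then have T: "sieve_on C Y T"
      and "T = maximal_sieve C Y \<or> (\<exists>I x. covering_presieve J (Y, I, x) \<and> x ` I \<subseteq> T)"
      by (auto simp: associated_sieves_def)
    from this(2) have "locally_in C J T (Id C Y)"
    proof (elim disjE exE conjE)
      assume "T = maximal_sieve C Y"
      then show ?thesis
        using Y by (auto intro: locally_in.base simp: maximal_sieve_def id_arr id_cod)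
    next
      fix I x assume cov: "covering_presieve J (Y, I, x)" and sub: "x ` I \<subseteq> T"
      have "locally_in C J T (Comp C (Id C Y) (x i))" if i: "i \<in> I" for i
        using sub i covering_presieve_is_presieve(2)[OF J(1) cov i] id_comp[of "x i"]
        by (auto intro: locally_in.base)
      then show ?thesis
        using Y cov by (intro locally_in.step[of "Id C Y"]) (simp_all add: id_arr id_dom)
    qed
    with T show "T \<in> K Y"
      by (simp add: K_def)
  qed
  moreover have "grothendieck_topology C K"
    unfolding K_def using J by (rule grothendieck_topology_local)
  ultimately have "S \<in> K X"
    by (auto simp: generated_topology_def)
  then show "locally_in C J S (Id C X)"
    by (simp add: K_def)
next
  assume loc: "locally_in C J S (Id C X)"
  have "S \<in> K X" if "grothendieck_topology C K" "\<forall>Y\<in>Obj C. associated_sieves C J Y \<subseteq> K Y" for K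
    using pullback_mem_topology[OF J(1) that(1) _ S loc] that(2) X
    by (simp add: pullback_sieve_id[OF S X] id_arr id_dom id_cod)
  then show "S \<in> generated_topology C (associated_sieves C J) X"
    by (auto simp: generated_topology_def)
qed

section \<open>From multi-coverings to local membership\<close>

lemma multi_covering_branch_comp:
  assumes "multi_covering C J X A f a0 Xs xs" and "X \<in> Obj C" and "a \<in> A n"
  shows "branch_comp C f Xs xs n a \<in> Arr C \<and> Dom C (branch_comp C f Xs xs n a) = Xs n a"
  using assms(3)
proof (induction n arbitrary: a)
  case 0
  then show ?case
    using assms(1,2) by (auto simp: multi_covering_def is_tree_def id_arr id_dom)
next
  case (Suc n)
  then have "f (Suc n) a \<in> A n"
    using assms(1) by (auto simp: multi_covering_def is_tree_def)
  from Suc.IH[OF this] show ?case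
    using assms(1) Suc.prems by (auto simp: multi_covering_def comp_arr comp_dom)
qed

text \<open>In a tree with finite branches a property holds at every node as soon as it passes from the
  children of a node to the node itself.\<close>

lemma multi_covering_imp_local:
  assumes mc: "multi_covering C J X A f a0 Xs xs" and X: "X \<in> Obj C"
    and leaf: "\<forall>n. \<forall>a\<in>A n.
          a \<in> f (Suc n) ` A (Suc n) \<or>
          covering_presieve J (Xs n a, {}, \<lambda>_. undefined) \<or>
          branch_comp C f Xs xs n a \<in> S"
  shows "locally_in C J S (Id C X)"
proof -
  let ?b = "branch_comp C f Xs xs"
  have tree: "is_tree A f a0" and fin: "finite_branches A f" and X0: "Xs 0 a0 = X"
    and cov: "\<And>n a. a \<in> A n \<Longrightarrow> fibre A f n a \<noteq> {} \<Longrightarrow>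
      covering_presieve J (Xs n a, fibre A f n a, xs (Suc n))"
    using mc by (auto simp: multi_covering_def)
  define N where "N = {(n, a). a \<in> A n \<and> \<not> locally_in C J S (?b n a)}"
  have "N = {}"
  proof (rule ccontr)
    assume "N \<noteq> {}"
    moreover have "N \<subseteq> nodes A"
      by (auto simp: N_def nodes_def)
    ultimately obtain n a where p: "(n, a) \<in> N"
      and maximal: "\<And>q. q \<in> N \<Longrightarrow> node_ge f q (n, a) \<Longrightarrow> q = (n, a)"
      using fin unfolding finite_branches_def by (metis surj_pair)
    have a: "a \<in> A n" and nloc: "\<not> locally_in C J S (?b n a)"
      using p by (auto simp: N_def)
    note b = multi_covering_branch_comp[OF mc X a]
    have "fibre A f n a \<noteq> {}" if "a \<in> f (Suc n) ` A (Suc n)"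
      using that by (auto simp: fibre_def)
    then consider "fibre A f n a \<noteq> {}" | "covering_presieve J (Xs n a, {}, \<lambda>_. undefined)" | "?b n a \<in> S"
      using leaf a by blast
    then have "locally_in C J S (?b n a)"
    proof cases
      case 1
      show ?thesis
      proof (rule locally_in.step)
        show "?b n a \<in> Arr C"
          using b by simp
        show "covering_presieve J (Dom C (?b n a), fibre A f n a, xs (Suc n))"
          using b cov[OF a 1] by simp
      next
        fix a' assume a': "a' \<in> fibre A f n a"
        have "node_ge f (Suc n, a') (n, a)"
          using a' by (auto simp: node_ge_def fibre_def Suc_diff_le)
        then have "(Suc n, a') \<notin> N"
          using maximal[of "(Suc n, a')"] by auto
        then show "locally_in C J S (Comp C (?b n a) (xs (Suc n) a'))"
          using a' by (simp add: N_def fibre_def)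
      qed
    next
      case 2
      then show ?thesis
        using b by (intro locally_in.step[of "?b n a" _ _ "{}"]) auto
    next
      case 3
      then show ?thesis
        by (rule locally_in.base)
    qed
    with nloc show False by simp
  qed
  moreover have "a0 \<in> A 0"
    using tree by (simp add: is_tree_def)
  ultimately have "locally_in C J S (?b 0 a0)"
    unfolding N_def by blast
  then show ?thesis
    by (simp add: X0)
qed

end

section \<open>From local membership to multi-coverings\<close>

text \<open>Derivations of \<^const>\<open>locally_in\<close> are recorded as data because choosing, for each arrow
  that is locally in \<open>S\<close>, some covering family as in the rule need not give a well-founded tree:
  the family may contain an identity, and then unfolding the choices never ends.\<close>

datatype ('m, 'u) derivation =
  Leaf
| Node (indices: "'u set") (arrow: "'u \<Rightarrow> 'm") (child: "'u \<Rightarrow> ('m, 'u) derivation")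
where
  "indices Leaf = {}"

primrec derives :: "('o, 'm) cat \<Rightarrow> ('o, 'm, 'u) presieve set \<Rightarrow> 'm set \<Rightarrow>
    ('m, 'u) derivation \<Rightarrow> 'm \<Rightarrow> bool" where
  "derives C J S Leaf = (\<lambda>g. g \<in> S)"
| "derives C J S (Node I x ts) = (\<lambda>g. g \<in> Arr C \<and> covering_presieve J (Dom C g, I, x) \<and>
     (\<forall>i\<in>I. derives C J S (ts i) (Comp C g (x i))))"

lemma locally_in_imp_derives:
  assumes "locally_in C J S g"
  shows "\<exists>t. derives C J S t g"
  using assms
proof induction
  case (base g)
  then have "derives C J S Leaf g"
    by simp
  then show ?case ..
next
  case (step g I x)
  then obtain ts where "\<forall>i\<in>I. derives C J S (ts i) (Comp C g (x i))"
    by metis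
  with step.hyps have "derives C J S (Node I x ts) g"
    by simp
  then show ?case ..
qed

definition child_rel :: "(('m, 'u) derivation \<times> ('m, 'u) derivation) set" where
  "child_rel = {(child t i, t) | t i. i \<in> indices t}"

lemma wf_child_rel: "wf child_rel"
proof (rule wfUNIVI)
  fix P :: "('m, 'u) derivation \<Rightarrow> bool" and t
  assume step: "\<forall>t. (\<forall>s. (s, t) \<in> child_rel \<longrightarrow> P s) \<longrightarrow> P t"
  show "P t"
  proof (induction t)
    case Leaf
    show ?case
      by (rule step[rule_format]) (auto simp: child_rel_def)
  next
    case (Node I x ts)
    then show ?case
      by (intro step[rule_format, of "Node I x ts"]) (auto simp: child_rel_def)
  qed
qed

lemma ex_pairing:
  includes cardinal_syntax
  assumes "infinite (UNIV :: 'u set)"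
  shows "\<exists>e :: 'u \<times> 'u \<Rightarrow> 'u. inj e"
proof -
  have "|UNIV \<times> UNIV :: ('u \<times> 'u) set| \<le>o |UNIV :: 'u set|"
    using card_of_Times_same_infinite[OF assms] by (rule ordIso_imp_ordLeq)
  then show ?thesis
    using card_of_ordLeq[of "UNIV \<times> UNIV :: ('u \<times> 'u) set" "UNIV :: 'u set"] by auto
qed

text \<open>The node of level \<open>n + 1\<close> reached from \<open>u\<close> by the index \<open>i\<close> is \<open>e (u, i)\<close>. Hence one and the
  same decoding gives the parent at every level, and a node determines its position in the
  derivation.\<close>

locale unfolding_tree = category C
  for C :: "('o, 'm) cat" +
  fixes J :: "('o, 'm, 'u) presieve set" and S :: "'m set" and X :: 'o
    and t :: "('m, 'u) derivation" and e :: "'u \<times> 'u \<Rightarrow> 'u" and a0 :: 'u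
  assumes J: "covering_notion C J" and X: "X \<in> Obj C" and S: "sieve_on C X S"
    and t: "derives C J S t (Id C X)" and e: "inj e"
begin

definition parent :: "'u \<Rightarrow> 'u" where "parent u = fst (inv e u)"

definition index :: "'u \<Rightarrow> 'u" where "index u = snd (inv e u)"

lemma parent_e [simp]: "parent (e (u, i)) = u" and index_e [simp]: "index (e (u, i)) = i"
  using e by (simp_all add: parent_def index_def)

primrec subtree :: "nat \<Rightarrow> 'u \<Rightarrow> ('m, 'u) derivation" where
  "subtree 0 u = t"
| "subtree (Suc n) u = child (subtree n (parent u)) (index u)"

primrec level :: "nat \<Rightarrow> 'u set" where
  "level 0 = {a0}"
| "level (Suc n) = {e (u, i) | u i. u \<in> level n \<and> i \<in> indices (subtree n u)}"

text \<open>Only levels \<open>n + 1\<close> carry an arrow to the parent; the value at level \<open>0\<close> is a dummy.\<close>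

definition edge :: "nat \<Rightarrow> 'u \<Rightarrow> 'm" where
  "edge n u = arrow (subtree (n - 1) (parent u)) (index u)"

primrec path :: "nat \<Rightarrow> 'u \<Rightarrow> 'm" where
  "path 0 u = Id C X"
| "path (Suc n) u = Comp C (path n (parent u)) (edge (Suc n) u)"

definition object :: "nat \<Rightarrow> 'u \<Rightarrow> 'o" where "object n u = Dom C (path n u)"

lemma derives_subtree: "u \<in> level n \<Longrightarrow> derives C J S (subtree n u) (path n u)"
proof (induction n arbitrary: u)
  case 0
  then show ?case
    using t by simp
next
  case (Suc n)
  then obtain v i where "v \<in> level n" "i \<in> indices (subtree n v)" "u = e (v, i)"
    by auto
  then show ?case
    using Suc.IH[of v] by (cases "subtree n v") (auto simp: edge_def)
qed

lemma path_arr: "u \<in> level n \<Longrightarrow> path n u \<in> Arr C"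
  using derives_subtree[of u n] sieve_on_arr[OF S] by (cases "subtree n u") auto

lemma covering_subtree:
  assumes "u \<in> level n" and "subtree n u = Node I x ts"
  shows "covering_presieve J (object n u, I, x)"
  using derives_subtree[OF assms(1)] assms(2) by (simp add: object_def)

lemma edge_props:
  assumes "u \<in> level (Suc n)"
  shows "edge (Suc n) u \<in> Arr C" "Dom C (edge (Suc n) u) = object (Suc n) u"
    "Cod C (edge (Suc n) u) = object n (parent u)"
proof -
  obtain v i where v: "v \<in> level n" and i: "i \<in> indices (subtree n v)" and u: "u = e (v, i)"
    using assms by auto
  obtain I x ts where sub: "subtree n v = Node I x ts"
    using i by (cases "subtree n v") auto
  have "x i \<in> Arr C \<and> Cod C (x i) = object n v"
    using covering_presieve_is_presieve(2)[OF J covering_subtree[OF v sub]] i sub by simp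
  then show "edge (Suc n) u \<in> Arr C" "Dom C (edge (Suc n) u) = object (Suc n) u"
    "Cod C (edge (Suc n) u) = object n (parent u)"
    using path_arr[OF v] by (auto simp: u edge_def sub object_def comp_dom)
qed

lemma fibre_level:
  assumes "u \<in> level n"
  shows "fibre level (\<lambda>_. parent) n u = (\<lambda>i. e (u, i)) ` indices (subtree n u)"
  using assms by (auto simp: fibre_def)

lemma subtree_descends:
  assumes "u \<in> level (n + k)"
  shows "(subtree (n + k) u, subtree n (iter_steps (\<lambda>_. parent) n k u)) \<in> child_rel ^^ k"
  using assms
proof (induction k arbitrary: u)
  case 0
  then show ?case
    by simp
next
  case (Suc k)
  then obtain v i where "v \<in> level (n + k)" "i \<in> indices (subtree (n + k) v)" "u = e (v, i)"
    by auto
  then have "(subtree (n + Suc k) u, subtree (n + k) v) \<in> child_rel"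
    and "(subtree (n + k) v, subtree n (iter_steps (\<lambda>_. parent) n k v)) \<in> child_rel ^^ k"
    using Suc.IH by (auto simp: child_rel_def)
  then have "(subtree (n + Suc k) u, subtree n (iter_steps (\<lambda>_. parent) n k v)) \<in> child_rel ^^ Suc k"
    by (rule relpow_Suc_I2)
  then show ?case
    using \<open>u = e (v, i)\<close> by (simp del: relpow.simps)
qed

lemma finite_branches_level: "finite_branches level (\<lambda>_. parent)"
  unfolding finite_branches_def
proof (intro allI impI, elim conjE)
  fix N assume N: "N \<subseteq> nodes level" "N \<noteq> {}"
  have "wf (inv_image (child_rel\<^sup>+) (\<lambda>(n, u). subtree n u))"
    by (intro wf_inv_image wf_trancl wf_child_rel)
  then obtain p where p: "p \<in> N"
    and minimal: "\<And>q. (q, p) \<in> inv_image (child_rel\<^sup>+) (\<lambda>(n, u). subtree n u) \<Longrightarrow> q \<notin> N"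
    using N(2) by (metis wfE_min ex_in_conv)
  obtain n u where p_eq: "p = (n, u)"
    by (cases p)
  have "q = p" if q: "q \<in> N" and ge: "node_ge (\<lambda>_. parent) q p" for q
  proof -
    obtain m v where q_eq: "q = (m, v)"
      by (cases q)
    obtain k where m: "m = n + k"
      using ge by (auto simp: node_ge_def p_eq q_eq dest: le_Suc_ex)
    have u: "u = iter_steps (\<lambda>_. parent) n k v" and v: "v \<in> level (n + k)"
      using ge q N(1) by (auto simp: node_ge_def p_eq q_eq m nodes_def)
    have "\<not> 0 < k"
    proof
      assume "0 < k"
      then have "(subtree m v, subtree n u) \<in> child_rel\<^sup>+"
        using subtree_descends[OF v] by (auto simp: u m trancl_power)
      then show False
        using minimal[of q] q by (simp add: p_eq q_eq)
    qed
    then show ?thesis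
      using u m by (simp add: p_eq q_eq)
  qed
  then show "\<exists>p\<in>N. \<forall>q\<in>N. node_ge (\<lambda>_. parent) q p \<longrightarrow> q = p"
    using p by blast
qed

lemma multi_covering_level: "multi_covering C J X level (\<lambda>_. parent) a0 object edge"
  unfolding multi_covering_def
proof (intro conjI allI ballI impI)
  show "is_tree level (\<lambda>_. parent) a0"
    by (auto simp: is_tree_def)
  show "object 0 a0 = X"
    using X by (simp add: object_def id_dom)
next
  fix n u assume u: "u \<in> level n" and "fibre level (\<lambda>_. parent) n u \<noteq> {}"
  then obtain I x ts where sub: "subtree n u = Node I x ts"
    using fibre_level by (cases "subtree n u") auto
  have "bij_betw index (fibre level (\<lambda>_. parent) n u) I"
    unfolding fibre_level[OF u] sub by (auto simp: bij_betw_def inj_on_def image_image)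
  then show "covering_presieve J (object n u, fibre level (\<lambda>_. parent) n u, edge (Suc n))"
    using covering_subtree[OF u sub]
    by (elim covering_presieve_reindex[rotated]) (auto simp: fibre_def edge_def sub)
qed (auto simp: finite_branches_level object_def path_arr dom_obj edge_props simp del: level.simps)

lemma branch_comp_level: "u \<in> level n \<Longrightarrow> branch_comp C (\<lambda>_. parent) object edge n u = path n u"
proof (induction n arbitrary: u)
  case 0
  then show ?case
    using X by (simp add: object_def id_dom)
qed auto

text \<open>A node without children is a leaf of the derivation or comes from an empty covering
  family.\<close>

lemma leaf_level:
  assumes u: "u \<in> level n"
  shows "u \<in> parent ` level (Suc n) \<or>
    covering_presieve J (object n u, {}, \<lambda>_. undefined) \<or>
    branch_comp C (\<lambda>_. parent) object edge n u \<in> S"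
proof (cases "subtree n u")
  case Leaf
  then show ?thesis
    using derives_subtree[OF u] branch_comp_level[OF u] by simp
next
  case (Node I x ts)
  show ?thesis
  proof (cases "I = {}")
    case True
    have "covering_presieve J (object n u, {}, \<lambda>_. undefined)"
      using covering_subtree[OF u Node]
      by (rule covering_presieve_reindex) (auto simp: True)
    then show ?thesis by simp
  next
    case False
    then obtain i where "i \<in> I" by blast
    then have "e (u, i) \<in> level (Suc n)"
      using u Node by (simp, intro exI[of _ u] exI[of _ i]) simp
    then have "parent (e (u, i)) \<in> parent ` level (Suc n)"
      by (rule imageI)
    then show ?thesis by simp
  qed
qed

end

theorem mainTheorem14:
  fixes C :: "('o, 'm) cat"
    and J :: "('o, 'm, 'u) presieve set"
    and X :: 'o
    and S :: "'m set"
  assumes "category C"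
    and "infinite (UNIV :: 'u set)"
    and "essentially_small TYPE('u) C"
    and "covering_notion C J"
    and "stable_notion C J"
    and "X \<in> Obj C"
    and "sieve_on C X S"
  shows "S \<in> generated_topology C (associated_sieves C J) X \<longleftrightarrow>
    (\<exists>(A :: nat \<Rightarrow> 'u set) f a0 Xs xs.
       multi_covering C J X A f a0 Xs xs \<and>
       (\<forall>n. \<forall>a\<in>A n.
          a \<in> f (Suc n) ` A (Suc n) \<or>
          covering_presieve J (Xs n a, {}, \<lambda>_. undefined) \<or>
          branch_comp C f Xs xs n a \<in> S))"
proof -
  interpret category C by fact
  note iff = mem_generated_topology_iff[OF assms(4-7)]
  show ?thesis (is "_ \<longleftrightarrow> ?R")
    unfolding iff
  proof
    assume "locally_in C J S (Id C X)"
    from locally_in_imp_derives[OF this] obtain t where t: "derives C J S t (Id C X)" ..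
    obtain e :: "'u \<times> 'u \<Rightarrow> 'u" where e: "inj e"
      using ex_pairing[OF assms(2)] by blast
    interpret T: unfolding_tree C J S X t e undefined
      using assms t e by unfold_locales
    show ?R
      using T.multi_covering_level T.leaf_level by (intro exI conjI allI ballI)
  next
    assume ?R
    then show "locally_in C J S (Id C X)"
      by (elim exE conjE) (rule multi_covering_imp_local[OF _ assms(6)])
  qed
qed

end
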